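(* Let $\Omega$ be an at most countable set, $\mathcal{F}=2^\Omega$, and let $(\Omega_t^+)_{t\in\mathbb{N}_0}$, $(\Omega_t^-)_{t\in\mathbb{N}_0}$ satisfy $\Omega=\Omega_t^-\sqcup\Omega_t^+$, $\Omega_t^+\subset\Omega_{t+1}^+$ and $\Omega_t^-\supset\Omega_{t+1}^-$ for all $t$. Let $\mathcal{P}$ be a nonempty set of (countably additive) probability measures on $(\Omega,\mathcal{F})$, and for each $t$ let $\mathcal{P}_t^{ex}$ be the associated set of extended probabilities, with lower and upper extended probabilities $\underline{P}_t^{ex}$ and $\overline{P}_t^{ex}$. Then for every $t\in\mathbb{N}_0$ and every $A\in\mathcal{F}$, $$\underline{P}^{ex}_{t+1}(A)\ \ge\ \sum_{\omega\in A\cap\Omega_{t+1}^+}\underline{P}^{ex}_{t+1}(\{\omega\})+\sum_{\omega\in A\cap\Omega_{t+1}^-}\underline{P}^{ex}_{t+1}(\{\omega\})$$ and $$\overline{P}^{ex}_{t+1}(A)\ \le\ \sum_{\omega\in A\cap\Omega_{t+1}^+}\overline{P}^{ex}_{t+1}(\{\omega\})+\sum_{\omega\in A\cap\Omega_{t+1}^-}\overline{P}^{ex}_{t+1}(\{\omega\}).$$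
   Context: $\mathbb{N}_0=\mathbb{N}\cup\{0\}$; $\sqcup$ denotes disjoint union. For each $t$, $\mathcal{P}_t^{ex}$ is the set of all set functions $P_t^{ex}(A)=P(A\cap\Omega_t^+)-P(A\cap\Omega_t^-)$, $A\in\mathcal{F}$, with $P\in\mathcal{P}$. The lower and upper extended probabilities are $\underline{P}^{ex}_t(A)=\inf_{P^{ex}\in\mathcal{P}^{ex}_t}P^{ex}(A)$ and $\overline{P}^{ex}_t(A)=\sup_{P^{ex}\in\mathcal{P}^{ex}_t}P^{ex}(A)$ for $A\in\mathcal{F}$. Infinite sums are understood in the extended reals: the terms indexed by $\Omega_{t+1}^+$ are nonnegative and those indexed by $\Omega_{t+1}^-$ are nonpositive. *)

theory Defs
  imports "HOL-Probability.Probability"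
begin

definition ext_prob ::
  "(nat \<Rightarrow> 'a set) \<Rightarrow> (nat \<Rightarrow> 'a set) \<Rightarrow> nat \<Rightarrow> 'a measure \<Rightarrow> 'a set \<Rightarrow> real" where
  "ext_prob \<Omega>p \<Omega>m t P A = measure P (A \<inter> \<Omega>p t) - measure P (A \<inter> \<Omega>m t)"

definition ext_probs ::
  "(nat \<Rightarrow> 'a set) \<Rightarrow> (nat \<Rightarrow> 'a set) \<Rightarrow> 'a measure set \<Rightarrow> nat \<Rightarrow> ('a set \<Rightarrow> real) set" where
  "ext_probs \<Omega>p \<Omega>m \<P> t = {ext_prob \<Omega>p \<Omega>m t P | P. P \<in> \<P>}"

text \<open>Extended probabilities take values in the interval from -1 to 1, so for nonempty
  \<open>\<P>\<close> the real-valued infimum and supremum below are never degenerate.\<close>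

definition lower_ext_prob ::
  "(nat \<Rightarrow> 'a set) \<Rightarrow> (nat \<Rightarrow> 'a set) \<Rightarrow> 'a measure set \<Rightarrow> nat \<Rightarrow> 'a set \<Rightarrow> real" where
  "lower_ext_prob \<Omega>p \<Omega>m \<P> t A = (INF Pex \<in> ext_probs \<Omega>p \<Omega>m \<P> t. Pex A)"

definition upper_ext_prob ::
  "(nat \<Rightarrow> 'a set) \<Rightarrow> (nat \<Rightarrow> 'a set) \<Rightarrow> 'a measure set \<Rightarrow> nat \<Rightarrow> 'a set \<Rightarrow> real" where
  "upper_ext_prob \<Omega>p \<Omega>m \<P> t A = (SUP Pex \<in> ext_probs \<Omega>p \<Omega>m \<P> t. Pex A)"

text \<open>Sums of extended reals of constant sign always converge, so for them \<^const>\<open>infsum\<close> is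
  the unordered sum and not its default value 0.\<close>

lemma ereal_nonneg_summable_on:
  fixes f :: "'a \<Rightarrow> ereal"
  assumes "\<And>x. x \<in> S \<Longrightarrow> 0 \<le> f x"
  shows "f summable_on S"
  using assms by (rule nonneg_summable_on_complete)

lemma ereal_nonpos_summable_on:
  fixes f :: "'a \<Rightarrow> ereal"
  assumes "\<And>x. x \<in> S \<Longrightarrow> f x \<le> 0"
  shows "f summable_on S"
proof -
  have "(\<lambda>x. - f x) summable_on S"
    using assms by (intro nonneg_summable_on_complete) auto
  then obtain l where "((\<lambda>x. - f x) has_sum l) S"
    by (auto simp: summable_on_def)
  then have "((\<lambda>F. - (\<Sum>x\<in>F. - f x)) \<longlongrightarrow> - l) (finite_subsets_at_top S)"
    unfolding has_sum_def by (rule tendsto_uminus_ereal)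
  moreover have "- (\<Sum>x\<in>F. - f x) = (\<Sum>x\<in>F. f x)" if "finite F" "F \<subseteq> S" for F
    using that
  proof (induction F rule: finite_induct)
    case (insert x F)
    have "0 \<le> - f x" and "0 \<le> (\<Sum>x\<in>F. - f x)"
      using assms insert.prems by (auto intro!: sum_nonneg)
    then have "- (- f x + (\<Sum>x\<in>F. - f x)) = f x + - (\<Sum>x\<in>F. - f x)"
      by (cases "f x"; cases "\<Sum>x\<in>F. - f x") auto
    with insert show ?case by simp
  qed simp
  ultimately have "(f has_sum - l) S"
    unfolding has_sum_def
    by (smt (verit, best) eventually_finite_subsets_at_top_weakI tendsto_cong)
  then show ?thesis by (auto simp: summable_on_def)
qed

end

theory Submission
  imports Defs
begin

text \<open>For each \<open>P\<close> the extended probability is countably additive, so it equals the sum of its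
  values on singletons over the positive part plus the one over the negative part. Bounding every
  summand by its infimum (supremum) over \<open>P\<close> gives a bound independent of \<open>P\<close>.\<close>

text \<open>An infinite \<open>B\<close> is enumerated by a bijection with the naturals, so
  countable additivity gives a convergent series. Its terms are nonnegative, so the series is also
  an unordered sum, which can be carried back along the bijection.\<close>

lemma (in finite_measure) has_sum_measure_singletons:
  assumes "countable B" and "\<And>x. x \<in> B \<Longrightarrow> {x} \<in> sets M"
  shows "((\<lambda>x. measure M {x}) has_sum measure M B) B"
proof (cases "finite B")
  case True
  then have "measure M B = (\<Sum>x\<in>B. measure M {x})"
    using assms(2) by (intro finite_measure_eq_sum_singleton)
  then show ?thesis
    using True by simp
next
  case False
  define e where "e = from_nat_into B"
  have e: "bij_betw e UNIV B"
    unfolding e_def using assms(1) False by (rule bij_betw_from_nat_into)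
  have eB: "e n \<in> B" for n
    using e by (auto simp: bij_betw_def)
  have "(\<lambda>n. measure M {e n}) sums measure M (\<Union>n. {e n})"
    using e eB assms(2)
    by (intro finite_measure_UNION) (auto simp: disjoint_family_on_def bij_betw_def inj_def)
  moreover have "(\<Union>n. {e n}) = B"
    using e by (auto simp: bij_betw_def)
  ultimately have "((\<lambda>n. measure M {e n}) has_sum measure M B) UNIV"
    by (intro sums_nonneg_imp_has_sum) auto
  then show ?thesis
    by (simp add: has_sum_reindex_bij_betw[OF e, of "\<lambda>x. measure M {x}"])
qed

lemma has_sum_ereal:
  assumes "(f has_sum s) S"
  shows "((\<lambda>x. ereal (f x)) has_sum ereal s) S"
proof -
  have "((\<lambda>F. ereal (sum f F)) \<longlongrightarrow> ereal s) (finite_subsets_at_top S)"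
    using assms unfolding has_sum_def by (rule tendsto_ereal)
  moreover have "sum (\<lambda>x. ereal (f x)) = (\<lambda>F. ereal (sum f F))"
    by (rule ext) simp
  ultimately show ?thesis
    by (simp add: has_sum_def)
qed

text \<open>Both measures in the difference are finite, so each is summed over singletons within the
  reals, where subtraction is harmless. Only the result is moved to \<open>ereal\<close>.\<close>

lemma has_sum_ext_prob:
  assumes "finite_measure P" "sets P = Pow \<Omega>" "countable \<Omega>" "B \<subseteq> \<Omega>"
  shows "((\<lambda>\<omega>. ereal (ext_prob \<Omega>p \<Omega>m s P {\<omega>})) has_sum ereal (ext_prob \<Omega>p \<Omega>m s P B)) B"
proof -
  interpret finite_measure P by fact
  have restrict: "((\<lambda>\<omega>. measure P ({\<omega>} \<inter> C)) has_sum measure P (B \<inter> C)) B" for C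
  proof -
    have "((\<lambda>\<omega>. measure P {\<omega>}) has_sum measure P (B \<inter> C)) (B \<inter> C)"
      using assms by (intro has_sum_measure_singletons) (auto intro: countable_subset)
    then show ?thesis
      \<comment> \<open>For points outside \<open>C\<close> the set
        \<open>{\<omega>} \<inter> C\<close> is empty, so those terms vanish.\<close>
      by (subst has_sum_cong_neutral[where T = "B \<inter> C" and g = "\<lambda>\<omega>. measure P {\<omega>}"]) auto
  qed
  show ?thesis
    unfolding ext_prob_def diff_conv_add_uminus
    by (intro has_sum_ereal has_sum_add) (simp_all add: has_sum_uminus restrict)
qed

lemma abs_ext_prob_le_1:
  assumes "prob_space P"
  shows "\<bar>ext_prob \<Omega>p \<Omega>m s P B\<bar> \<le> 1"
proof -
  interpret prob_space P by fact
  have "0 \<le> measure P X \<and> measure P X \<le> 1" for X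
    by (simp add: prob_le_1)
  from this[of "B \<inter> \<Omega>p s"] this[of "B \<inter> \<Omega>m s"] show ?thesis
    unfolding ext_prob_def by linarith
qed

lemma lower_ext_prob_eq: "lower_ext_prob \<Omega>p \<Omega>m \<P> s B = (INF P\<in>\<P>. ext_prob \<Omega>p \<Omega>m s P B)"
  unfolding lower_ext_prob_def ext_probs_def Setcompr_eq_image by (simp add: image_image)

lemma upper_ext_prob_eq: "upper_ext_prob \<Omega>p \<Omega>m \<P> s B = (SUP P\<in>\<P>. ext_prob \<Omega>p \<Omega>m s P B)"
  unfolding upper_ext_prob_def ext_probs_def Setcompr_eq_image by (simp add: image_image)

text \<open>Lets a possibly infinite bound pass to a real infimum: the value
  \<open>-\<infinity>\<close> is trivial, and \<open>\<infinity>\<close> is excluded because some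
  real \<open>f i\<close> lies above \<open>u\<close>.\<close>

lemma ereal_le_cINF:
  assumes "I \<noteq> {}" and "\<And>i. i \<in> I \<Longrightarrow> u \<le> ereal (f i)"
  shows "u \<le> ereal (INF i\<in>I. f i)"
proof (cases u)
  case (real r)
  then show ?thesis
    using assms by (auto intro!: cINF_greatest)
qed (use assms in auto)

lemma cSUP_le_ereal:
  assumes "I \<noteq> {}" and "\<And>i. i \<in> I \<Longrightarrow> ereal (f i) \<le> u"
  shows "ereal (SUP i\<in>I. f i) \<le> u"
proof (cases u)
  case (real r)
  then show ?thesis
    using assms by (auto intro!: cSUP_least)
qed (use assms in auto)

theorem mainTheorem4:
  fixes \<Omega> :: "'a set"
    and \<Omega>p \<Omega>m :: "nat \<Rightarrow> 'a set"
    and \<P> :: "'a measure set"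
    and t :: nat
    and A :: "'a set"
  assumes "countable \<Omega>"
    and "\<And>s. \<Omega> = \<Omega>m s \<union> \<Omega>p s"
    and "\<And>s. \<Omega>m s \<inter> \<Omega>p s = {}"
    and "\<And>s. \<Omega>p s \<subseteq> \<Omega>p (s + 1)"
    and "\<And>s. \<Omega>m (s + 1) \<subseteq> \<Omega>m s"
    and "\<P> \<noteq> {}"
    and "\<And>P. P \<in> \<P> \<Longrightarrow> prob_space P \<and> space P = \<Omega> \<and> sets P = Pow \<Omega>"
    and "A \<in> Pow \<Omega>"
  shows "ereal (lower_ext_prob \<Omega>p \<Omega>m \<P> (t + 1) A) \<ge>
      (\<Sum>\<^sub>\<infinity>\<omega>\<in>A \<inter> \<Omega>p (t + 1). ereal (lower_ext_prob \<Omega>p \<Omega>m \<P> (t + 1) {\<omega>})) +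
      (\<Sum>\<^sub>\<infinity>\<omega>\<in>A \<inter> \<Omega>m (t + 1). ereal (lower_ext_prob \<Omega>p \<Omega>m \<P> (t + 1) {\<omega>})) \<and>
    ereal (upper_ext_prob \<Omega>p \<Omega>m \<P> (t + 1) A) \<le>
      (\<Sum>\<^sub>\<infinity>\<omega>\<in>A \<inter> \<Omega>p (t + 1). ereal (upper_ext_prob \<Omega>p \<Omega>m \<P> (t + 1) {\<omega>})) +
      (\<Sum>\<^sub>\<infinity>\<omega>\<in>A \<inter> \<Omega>m (t + 1). ereal (upper_ext_prob \<Omega>p \<Omega>m \<P> (t + 1) {\<omega>}))"
proof -
  define s where "s = t + 1"
  let ?L = "lower_ext_prob \<Omega>p \<Omega>m \<P> s" and ?U = "upper_ext_prob \<Omega>p \<Omega>m \<P> s"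
  let ?E = "ext_prob \<Omega>p \<Omega>m s"
  have abs: "\<bar>?E P B\<bar> \<le> 1" if "P \<in> \<P>" for P B
    using assms(7)[OF that] by (simp add: abs_ext_prob_le_1)
  \<comment> \<open>The reals are only conditionally complete, so comparing \<open>INF\<close> and
    \<open>SUP\<close> with a member of the family requires these bounds.\<close>
  have bdd: "bdd_below ((\<lambda>P. ?E P B) ` \<P>)" "bdd_above ((\<lambda>P. ?E P B) ` \<P>)" for B
    using abs by (force intro!: bdd_belowI2[where m = "-1"] bdd_aboveI2[where M = 1] simp: abs_le_iff)+
  have lower: "?L B \<le> ?E P B" and upper: "?E P B \<le> ?U B" if "P \<in> \<P>" for P B
    using that bdd by (auto simp: lower_ext_prob_eq upper_ext_prob_eq intro: cINF_lower cSUP_upper)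
  have Ep: "?E P {\<omega>} \<ge> 0" if "\<omega> \<in> \<Omega>p s" for P \<omega>
  proof -
    have "{\<omega>} \<inter> \<Omega>m s = {}"
      using that assms(3)[of s] by auto
    then show ?thesis
      by (simp add: ext_prob_def)
  qed
  have Em: "?E P {\<omega>} \<le> 0" if "\<omega> \<in> \<Omega>m s" for P \<omega>
  proof -
    have "{\<omega>} \<inter> \<Omega>p s = {}"
      using that assms(3)[of s] by auto
    then show ?thesis
      by (simp add: ext_prob_def)
  qed
  \<comment> \<open>One member fixes the remaining signs: on the positive part \<open>?U\<close>
    lies above a nonnegative value, on the negative part \<open>?L\<close> lies below a nonpositive
    one.\<close>
  obtain P0 where P0: "P0 \<in> \<P>"
    using assms(6) by auto
  have signs:
    "?L {\<omega>} \<ge> 0" "?U {\<omega>} \<ge> 0" if "\<omega> \<in> \<Omega>p s" for \<omega>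
    using that Ep[OF that] assms(6) upper[OF P0, of "{\<omega>}"]
    by (auto simp: lower_ext_prob_eq intro!: cINF_greatest intro: order_trans)
  have signs':
    "?L {\<omega>} \<le> 0" "?U {\<omega>} \<le> 0" if "\<omega> \<in> \<Omega>m s" for \<omega>
    using that Em[OF that] assms(6) lower[OF P0, of "{\<omega>}"]
    by (auto simp: upper_ext_prob_eq intro!: cSUP_least intro: order_trans)
  \<comment> \<open>This rules out the default value 0 of \<open>infsum\<close>, so that
    \<open>has_sum_infsum\<close> applies even to a divergent sum.\<close>
  have summable:
    "(\<lambda>\<omega>. ereal (?L {\<omega>})) summable_on (A \<inter> \<Omega>p s)" "(\<lambda>\<omega>. ereal (?U {\<omega>})) summable_on (A \<inter> \<Omega>p s)"
    by (rule ereal_nonneg_summable_on, simp add: signs)+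
  have summable':
    "(\<lambda>\<omega>. ereal (?L {\<omega>})) summable_on (A \<inter> \<Omega>m s)" "(\<lambda>\<omega>. ereal (?U {\<omega>})) summable_on (A \<inter> \<Omega>m s)"
    by (rule ereal_nonpos_summable_on, simp add: signs')+
  have sums: "((\<lambda>\<omega>. ereal (?E P {\<omega>})) has_sum ereal (?E P B)) B" if "P \<in> \<P>" "B \<subseteq> A" for P B
    using assms(1,7,8) that
    by (intro has_sum_ext_prob[where \<Omega> = \<Omega>]) (auto simp: prob_space.finite_measure)
  \<comment> \<open>On each half only one of the two measures in \<open>ext_prob\<close>
    survives.\<close>
  have split: "ereal (?E P A) = ereal (?E P (A \<inter> \<Omega>p s)) + ereal (?E P (A \<inter> \<Omega>m s))" for P
  proof -
    have "A \<inter> \<Omega>p s \<inter> \<Omega>p s = A \<inter> \<Omega>p s" "A \<inter> \<Omega>p s \<inter> \<Omega>m s = {}"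
      "A \<inter> \<Omega>m s \<inter> \<Omega>m s = A \<inter> \<Omega>m s" "A \<inter> \<Omega>m s \<inter> \<Omega>p s = {}"
      using assms(3)[of s] by auto
    then show ?thesis
      by (simp add: ext_prob_def)
  qed
  \<comment> \<open>The first sum is at most the finite value
    \<open>?E P (A \<inter> \<Omega>p s)\<close>, so only the second can be infinite and
    \<open>\<infinity> - \<infinity>\<close> never arises. For \<open>?U\<close> the roles are
    exchanged.\<close>
  have "(\<Sum>\<^sub>\<infinity>\<omega>\<in>A \<inter> \<Omega>p s. ereal (?L {\<omega>})) + (\<Sum>\<^sub>\<infinity>\<omega>\<in>A \<inter> \<Omega>m s. ereal (?L {\<omega>})) \<le> ereal (?E P A)"
    if P: "P \<in> \<P>" for P
    unfolding split using P
    by (intro add_mono has_sum_mono[OF has_sum_infsum sums])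
       (auto intro: summable summable' lower)
  moreover have "ereal (?E P A) \<le>
      (\<Sum>\<^sub>\<infinity>\<omega>\<in>A \<inter> \<Omega>p s. ereal (?U {\<omega>})) + (\<Sum>\<^sub>\<infinity>\<omega>\<in>A \<inter> \<Omega>m s. ereal (?U {\<omega>}))"
    if P: "P \<in> \<P>" for P
    unfolding split using P
    by (intro add_mono has_sum_mono[OF sums has_sum_infsum])
       (auto intro: summable summable' upper)
  \<comment> \<open>The bounds do not depend on \<open>P\<close>. Unfolding at \<open>A\<close>
    alone leaves the singleton terms in the sums folded.\<close>
  ultimately show ?thesis
    using assms(6) unfolding s_def[symmetric] lower_ext_prob_eq[of _ _ _ _ A] upper_ext_prob_eq[of _ _ _ _ A]
    by (intro conjI ereal_le_cINF cSUP_le_ereal)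
qed

end
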